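(* Let $(\mathcal{P}=P_1\oplus P_2,\odot,\{\!\!\{~,~\}\!\!\})$ be a proto-twilled Poisson algebra over a field $\mathbf{k}$ of characteristic $0$, with structure maps $\cdot_1,\cdot_2,\mu,\nu,h,\theta,\{~,~\}_1,\{~,~\}_2,\rho,\psi,H,\Theta$, and let $r:P_2\to P_1$ be a deformation map on it. Then the vector space $P_2$ inherits a Poisson algebra structure whose multiplication and Lie bracket are respectively given by $$u\cdot_rv:=\mathrm{pr}_2\big((r(u),u)\odot(r(v),v)\big)=u\cdot_2v+\mu_{r(u)}v+\mu_{r(v)}u+h(r(u),r(v)),$$ $$\{u,v\}_r:=\mathrm{pr}_2\{\!\!\{(r(u),u),(r(v),v)\}\!\!\}=\{u,v\}_2+\rho_{r(u)}v-\rho_{r(v)}u+H(r(u),r(v)),$$ for $u,v\in P_2$, where $\mathrm{pr}_2:P_1\oplus P_2\to P_2$ is the projection.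
   Context: A Poisson algebra is a vector space with a commutative associative product and a Lie bracket such that the bracket satisfies the Leibniz rule $\{x,yz\}=\{x,y\}z+y\{x,z\}$. A proto-twilled Poisson algebra is a Poisson algebra $(\mathcal{P},\odot,\{\!\!\{~,~\}\!\!\})$ whose underlying vector space has a direct sum decomposition $\mathcal{P}=P_1\oplus P_2$ into subspaces (not necessarily subalgebras). Its structure maps are the (bi)linear maps $\cdot_1:P_1\times P_1\to P_1$, $\cdot_2:P_2\times P_2\to P_2$, $h:P_1\times P_1\to P_2$, $\theta:P_2\times P_2\to P_1$ (symmetric), $\{~,~\}_1:P_1\times P_1\to P_1$, $\{~,~\}_2:P_2\times P_2\to P_2$, $H:P_1\times P_1\to P_2$, $\Theta:P_2\times P_2\to P_1$ (antisymmetric), $\mu,\rho:P_1\to\mathrm{End}(P_2)$, $\nu,\psi:P_2\to\mathrm{End}(P_1)$ uniquely determined by $$(x,u)\odot(y,v)=\big(x\cdot_1y+\nu_uy+\nu_vx+\theta(u,v),\ u\cdot_2v+\mu_xv+\mu_yu+h(x,y)\big),$$ $$\{\!\!\{(x,u),(y,v)\}\!\!\}=\big(\{x,y\}_1+\psi_uy-\psi_vx+\Theta(u,v),\ \{u,v\}_2+\rho_xv-\rho_yu+H(x,y)\big).$$ A linear map $r:P_2\to P_1$ is a deformation map if its graph $Gr(r)=\{(r(u),u)\mid u\in P_2\}$ is a Poisson subalgebra of $\mathcal{P}$ (closed under $\odot$ and $\{\!\!\{~,~\}\!\!\}$). *)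

theory Defs
  imports Complex_Main "HOL-Library.FuncSet"
begin

text \<open>
  Algebras live on subspaces of an ambient vector space, so that a vector space together with a
  direct sum decomposition into subspaces, and a Poisson algebra structure on one of the summands,
  can all be expressed with one notion.  Operations are only constrained on these carriers.
\<close>

definition linear_on ::
  "('k::field \<Rightarrow> 'v::ab_group_add \<Rightarrow> 'v) \<Rightarrow> 'v set \<Rightarrow> 'v set \<Rightarrow> ('v \<Rightarrow> 'v) \<Rightarrow> bool" where
  "linear_on scale A B f \<longleftrightarrow> f \<in> A \<rightarrow> B
     \<and> (\<forall>x\<in>A. \<forall>y\<in>A. f (x + y) = f x + f y)
     \<and> (\<forall>c. \<forall>x\<in>A. f (scale c x) = scale c (f x))"

definition bilinear_on ::
  "('k::field \<Rightarrow> 'v::ab_group_add \<Rightarrow> 'v) \<Rightarrow> 'v set \<Rightarrow> 'v set \<Rightarrow> 'v set \<Rightarrow> ('v \<Rightarrow> 'v \<Rightarrow> 'v) \<Rightarrow> bool" where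
  "bilinear_on scale A B C f \<longleftrightarrow>
     (\<forall>x\<in>A. linear_on scale B C (\<lambda>y. f x y)) \<and> (\<forall>y\<in>B. linear_on scale A C (\<lambda>x. f x y))"

locale poisson_algebra = vector_space scale
  for scale :: "'k::field \<Rightarrow> 'v::ab_group_add \<Rightarrow> 'v" +
  fixes P :: "'v set"
    and mult :: "'v \<Rightarrow> 'v \<Rightarrow> 'v"
    and brack :: "'v \<Rightarrow> 'v \<Rightarrow> 'v"
  assumes subspace_carrier: "subspace P"
    and mult_bilinear: "bilinear_on scale P P P mult"
    and mult_assoc: "\<lbrakk>x \<in> P; y \<in> P; z \<in> P\<rbrakk> \<Longrightarrow> mult (mult x y) z = mult x (mult y z)"
    and mult_commute: "\<lbrakk>x \<in> P; y \<in> P\<rbrakk> \<Longrightarrow> mult x y = mult y x"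
    and brack_bilinear: "bilinear_on scale P P P brack"
    and brack_self: "x \<in> P \<Longrightarrow> brack x x = 0"
    and jacobi: "\<lbrakk>x \<in> P; y \<in> P; z \<in> P\<rbrakk> \<Longrightarrow>
      brack x (brack y z) + brack y (brack z x) + brack z (brack x y) = 0"
    and leibniz: "\<lbrakk>x \<in> P; y \<in> P; z \<in> P\<rbrakk> \<Longrightarrow>
      brack x (mult y z) = mult (brack x y) z + mult y (brack x z)"

text \<open>
  The direct sum is internal: an element written \<open>(x, u)\<close> in \<open>P1 \<oplus> P2\<close> is the sum \<open>x + u\<close> with
  \<open>x \<in> P1\<close> and \<open>u \<in> P2\<close>.
\<close>

locale proto_twilled_poisson_algebra = poisson_algebra scale P mult brack
  for scale :: "'k::field \<Rightarrow> 'v::ab_group_add \<Rightarrow> 'v"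
    and P :: "'v set"
    and mult :: "'v \<Rightarrow> 'v \<Rightarrow> 'v"
    and brack :: "'v \<Rightarrow> 'v \<Rightarrow> 'v" +
  fixes P1 P2 :: "'v set"
  assumes subspace_P1: "subspace P1"
    and subspace_P2: "subspace P2"
    and sum_P1_P2: "P = {x + u | x u. x \<in> P1 \<and> u \<in> P2}"
    and direct_P1_P2: "P1 \<inter> P2 = {0}"

definition pr2 :: "'v::ab_group_add set \<Rightarrow> 'v set \<Rightarrow> 'v \<Rightarrow> 'v" where
  "pr2 P1 P2 p = (THE u. u \<in> P2 \<and> (\<exists>x\<in>P1. p = x + u))"

text \<open>
  A linear map from \<open>P1\<close> to \<open>End P2\<close> is the same thing as a bilinear map \<open>P1 \<times> P2 \<rightarrow> P2\<close>.
  In the last two axioms, the first parenthesis of the right-hand side is the component in \<open>P1\<close>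
  and the second one the component in \<open>P2\<close>.
\<close>

locale proto_twilled_structure_maps =
  proto_twilled_poisson_algebra scale P mult brack P1 P2
  for scale :: "'k::field \<Rightarrow> 'v::ab_group_add \<Rightarrow> 'v"
    and P :: "'v set"
    and mult :: "'v \<Rightarrow> 'v \<Rightarrow> 'v"
    and brack :: "'v \<Rightarrow> 'v \<Rightarrow> 'v"
    and P1 P2 :: "'v set" +
  fixes dot1 dot2 \<mu> \<nu> h \<theta> :: "'v \<Rightarrow> 'v \<Rightarrow> 'v"
    and brack1 brack2 \<rho> \<psi> H \<Theta> :: "'v \<Rightarrow> 'v \<Rightarrow> 'v"
  assumes dot1_bilinear: "bilinear_on scale P1 P1 P1 dot1"
    and dot2_bilinear: "bilinear_on scale P2 P2 P2 dot2"
    and \<mu>_bilinear: "bilinear_on scale P1 P2 P2 \<mu>"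
    and \<nu>_bilinear: "bilinear_on scale P2 P1 P1 \<nu>"
    and h_bilinear: "bilinear_on scale P1 P1 P2 h"
    and \<theta>_bilinear: "bilinear_on scale P2 P2 P1 \<theta>"
    and dot1_sym: "\<lbrakk>x \<in> P1; y \<in> P1\<rbrakk> \<Longrightarrow> dot1 x y = dot1 y x"
    and dot2_sym: "\<lbrakk>u \<in> P2; v \<in> P2\<rbrakk> \<Longrightarrow> dot2 u v = dot2 v u"
    and h_sym: "\<lbrakk>x \<in> P1; y \<in> P1\<rbrakk> \<Longrightarrow> h x y = h y x"
    and \<theta>_sym: "\<lbrakk>u \<in> P2; v \<in> P2\<rbrakk> \<Longrightarrow> \<theta> u v = \<theta> v u"
    and brack1_bilinear: "bilinear_on scale P1 P1 P1 brack1"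
    and brack2_bilinear: "bilinear_on scale P2 P2 P2 brack2"
    and \<rho>_bilinear: "bilinear_on scale P1 P2 P2 \<rho>"
    and \<psi>_bilinear: "bilinear_on scale P2 P1 P1 \<psi>"
    and H_bilinear: "bilinear_on scale P1 P1 P2 H"
    and \<Theta>_bilinear: "bilinear_on scale P2 P2 P1 \<Theta>"
    and brack1_antisym: "\<lbrakk>x \<in> P1; y \<in> P1\<rbrakk> \<Longrightarrow> brack1 x y = - brack1 y x"
    and brack2_antisym: "\<lbrakk>u \<in> P2; v \<in> P2\<rbrakk> \<Longrightarrow> brack2 u v = - brack2 v u"
    and H_antisym: "\<lbrakk>x \<in> P1; y \<in> P1\<rbrakk> \<Longrightarrow> H x y = - H y x"
    and \<Theta>_antisym: "\<lbrakk>u \<in> P2; v \<in> P2\<rbrakk> \<Longrightarrow> \<Theta> u v = - \<Theta> v u"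
    and mult_decomp: "\<lbrakk>x \<in> P1; y \<in> P1; u \<in> P2; v \<in> P2\<rbrakk> \<Longrightarrow>
      mult (x + u) (y + v) =
        (dot1 x y + \<nu> u y + \<nu> v x + \<theta> u v) + (dot2 u v + \<mu> x v + \<mu> y u + h x y)"
    and brack_decomp: "\<lbrakk>x \<in> P1; y \<in> P1; u \<in> P2; v \<in> P2\<rbrakk> \<Longrightarrow>
      brack (x + u) (y + v) =
        (brack1 x y + \<psi> u y - \<psi> v x + \<Theta> u v) + (brack2 u v + \<rho> x v - \<rho> y u + H x y)"

text \<open>The graph of \<open>r\<close>, whose elements \<open>(r(u), u)\<close> are again sums.\<close>

definition graph_of :: "'v::ab_group_add set \<Rightarrow> ('v \<Rightarrow> 'v) \<Rightarrow> 'v set" where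
  "graph_of P2 r = {r u + u | u. u \<in> P2}"

definition poisson_subalgebra ::
  "('k::field \<Rightarrow> 'v::ab_group_add \<Rightarrow> 'v) \<Rightarrow> 'v set \<Rightarrow> ('v \<Rightarrow> 'v \<Rightarrow> 'v) \<Rightarrow> ('v \<Rightarrow> 'v \<Rightarrow> 'v) \<Rightarrow> 'v set \<Rightarrow> bool"
  where
  "poisson_subalgebra scale P mult brack S \<longleftrightarrow>
     S \<subseteq> P \<and> module.subspace scale S
     \<and> (\<forall>x\<in>S. \<forall>y\<in>S. mult x y \<in> S) \<and> (\<forall>x\<in>S. \<forall>y\<in>S. brack x y \<in> S)"

definition deformation_map ::
  "('k::field \<Rightarrow> 'v::ab_group_add \<Rightarrow> 'v) \<Rightarrow> 'v set \<Rightarrow> ('v \<Rightarrow> 'v \<Rightarrow> 'v) \<Rightarrow> ('v \<Rightarrow> 'v \<Rightarrow> 'v)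
    \<Rightarrow> 'v set \<Rightarrow> 'v set \<Rightarrow> ('v \<Rightarrow> 'v) \<Rightarrow> bool"
  where
  "deformation_map scale P mult brack P1 P2 r \<longleftrightarrow>
     linear_on scale P2 P1 r
     \<and> poisson_subalgebra scale P mult brack (graph_of P2 r)"

end

theory Submission imports Defs begin

text \<open>
  The map \<open>g u = r u + u\<close> is a linear bijection from \<open>P2\<close> onto the graph of \<open>r\<close>, with inverse the
  restriction of \<open>pr2\<close>.  As the graph is a Poisson subalgebra, its operations can be transported
  to \<open>P2\<close> along this bijection.
\<close>

lemma linear_on_mem: "linear_on scale A B f \<Longrightarrow> x \<in> A \<Longrightarrow> f x \<in> B"
  by (auto simp: linear_on_def)

lemma linear_on_add: "linear_on scale A B f \<Longrightarrow> x \<in> A \<Longrightarrow> y \<in> A \<Longrightarrow> f (x + y) = f x + f y"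
  by (simp add: linear_on_def)

lemma linear_on_zero: "linear_on scale A B f \<Longrightarrow> 0 \<in> A \<Longrightarrow> f 0 = 0"
  using linear_on_add[of scale A B f 0 0] by simp

lemma linear_on_compose:
  "linear_on scale A B f \<Longrightarrow> linear_on scale B C g \<Longrightarrow> linear_on scale A C (\<lambda>x. g (f x))"
  by (auto simp: linear_on_def Pi_iff)

lemma bilinear_on_mem: "bilinear_on scale A B C f \<Longrightarrow> x \<in> A \<Longrightarrow> y \<in> B \<Longrightarrow> f x y \<in> C"
  by (auto simp: bilinear_on_def intro: linear_on_mem)

text \<open>Made for pulling a product back along a linear map in each argument and then projecting
  the result. Fixing one argument leaves a composite of linear maps in the other.\<close>

lemma bilinear_on_compose:
  assumes "bilinear_on scale A B C f"
    and "linear_on scale A' A g" and "linear_on scale B' B g'" and "linear_on scale C C' p"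
  shows "bilinear_on scale A' B' C' (\<lambda>x y. p (f (g x) (g' y)))"
  unfolding bilinear_on_def
proof (intro conjI ballI)
  fix x assume "x \<in> A'"
  then have "linear_on scale B C (f (g x))"
    using assms(1,2) linear_on_mem by (fastforce simp: bilinear_on_def)
  then show "linear_on scale B' C' (\<lambda>y. p (f (g x) (g' y)))"
    using assms(3,4) linear_on_compose by blast
next
  fix y assume "y \<in> B'"
  then have "linear_on scale A C (\<lambda>x. f x (g' y))"
    using assms(1,3) linear_on_mem by (fastforce simp: bilinear_on_def)
  then show "linear_on scale A' C' (\<lambda>x. p (f (g x) (g' y)))"
    using linear_on_compose[OF linear_on_compose[OF assms(2)] assms(4)] by blast
qed

text \<open>Since \<open>p\<close> is a left inverse of \<open>g\<close> on \<open>Q\<close>, the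
  composite of \<open>p\<close> followed by \<open>g\<close> fixes every element of the image of
  \<open>g\<close>. The image is closed under both operations, so inner occurrences of this
  composite cancel in nested expressions, and each axiom on \<open>Q\<close> becomes
  \<open>p\<close> applied to an axiom on \<open>P\<close>.\<close>

lemma (in poisson_algebra) transport:
  assumes Q: "subspace Q"
    and g: "linear_on scale Q P g" and p: "linear_on scale P Q p"
    and pg: "\<And>u. u \<in> Q \<Longrightarrow> p (g u) = u"
    and mult_closed: "\<And>u v. u \<in> Q \<Longrightarrow> v \<in> Q \<Longrightarrow> mult (g u) (g v) \<in> g ` Q"
    and brack_closed: "\<And>u v. u \<in> Q \<Longrightarrow> v \<in> Q \<Longrightarrow> brack (g u) (g v) \<in> g ` Q"
  shows "poisson_algebra scale Q (\<lambda>u v. p (mult (g u) (g v))) (\<lambda>u v. p (brack (g u) (g v)))"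
proof -
  note g_mem = linear_on_mem[OF g]
  note m_mem = bilinear_on_mem[OF mult_bilinear]
  note b_mem = bilinear_on_mem[OF brack_bilinear]
  note p_add = linear_on_add[OF p]
  have p_zero: "p 0 = 0"
    using linear_on_zero[OF p] subspace_0[OF subspace_carrier] .
  \<comment> \<open>By closure the product has the form \<open>g w\<close> with \<open>w\<close> in
    \<open>Q\<close>, and \<open>p (g w) = w\<close>. Without closure, applying \<open>p\<close>
    could lose information.\<close>
  have gp_mult: "g (p (mult (g u) (g v))) = mult (g u) (g v)" if "u \<in> Q" "v \<in> Q" for u v
    using mult_closed[OF that] pg by auto
  have gp_brack: "g (p (brack (g u) (g v))) = brack (g u) (g v)" if "u \<in> Q" "v \<in> Q" for u v
    using brack_closed[OF that] pg by auto
  show ?thesis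
  proof
    show "subspace Q" by (fact Q)
    show "bilinear_on scale Q Q Q (\<lambda>u v. p (mult (g u) (g v)))"
      by (rule bilinear_on_compose[OF mult_bilinear g g p])
    show "bilinear_on scale Q Q Q (\<lambda>u v. p (brack (g u) (g v)))"
      by (rule bilinear_on_compose[OF brack_bilinear g g p])
  next
    fix x y assume "x \<in> Q" "y \<in> Q"
    then show "p (mult (g x) (g y)) = p (mult (g y) (g x))"
      by (simp add: mult_commute g_mem)
  next
    fix x assume "x \<in> Q"
    then show "p (brack (g x) (g x)) = 0"
      by (simp add: brack_self g_mem p_zero)
  next
    fix x y z assume xyz: "x \<in> Q" "y \<in> Q" "z \<in> Q"
    show "p (mult (g (p (mult (g x) (g y)))) (g z)) = p (mult (g x) (g (p (mult (g y) (g z)))))"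
      using xyz by (simp add: gp_mult mult_assoc g_mem)
    \<comment> \<open>The inner brackets are written here with \<open>g\<close> and \<open>p\<close>
      already cancelled. Additivity of \<open>p\<close> on \<open>P\<close> gathers the cyclic sum
      into one argument, where the Jacobi identity of \<open>P\<close> applies.\<close>
    have "p (brack (g x) (brack (g y) (g z))) + p (brack (g y) (brack (g z) (g x)))
        + p (brack (g z) (brack (g x) (g y)))
      = p (brack (g x) (brack (g y) (g z)) + brack (g y) (brack (g z) (g x))
        + brack (g z) (brack (g x) (g y)))"
      using xyz by (simp add: p_add g_mem b_mem subspace_add[OF subspace_carrier])
    also have "\<dots> = 0"
      using xyz by (simp add: jacobi g_mem p_zero)
    finally show "p (brack (g x) (g (p (brack (g y) (g z)))))
        + p (brack (g y) (g (p (brack (g z) (g x)))))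
        + p (brack (g z) (g (p (brack (g x) (g y))))) = 0"
      using xyz by (simp add: gp_brack)
    show "p (brack (g x) (g (p (mult (g y) (g z)))))
      = p (mult (g (p (brack (g x) (g y)))) (g z)) + p (mult (g y) (g (p (brack (g x) (g z)))))"
      using xyz by (simp add: gp_mult gp_brack leibniz p_add g_mem m_mem b_mem)
  qed
qed

context proto_twilled_poisson_algebra
begin

lemma sum_mem: "x \<in> P1 \<Longrightarrow> u \<in> P2 \<Longrightarrow> x + u \<in> P"
  using sum_P1_P2 by blast

text \<open>Uniqueness of the decomposition in a direct sum makes the definite description in
  \<open>pr2\<close> well defined. Later facts use \<open>pr2\<close> only through this
  equation.\<close>

lemma pr2_sum:
  assumes "x \<in> P1" "u \<in> P2"
  shows "pr2 P1 P2 (x + u) = u"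
  unfolding pr2_def
proof (rule the_equality)
  show "u \<in> P2 \<and> (\<exists>y\<in>P1. x + u = y + u)"
    using assms by blast
next
  fix v assume "v \<in> P2 \<and> (\<exists>y\<in>P1. x + u = y + v)"
  then obtain y where v: "v \<in> P2" and y: "y \<in> P1" and eq: "x + u = y + v"
    by blast
  \<comment> \<open>The left side lies in \<open>P1\<close> and the right side in \<open>P2\<close>,
    so the common value lies in the trivial intersection.\<close>
  from eq have "x - y = v - u"
    by (simp add: algebra_simps)
  moreover have "x - y \<in> P1"
    by (rule subspace_diff[OF subspace_P1 assms(1) y])
  moreover have "v - u \<in> P2"
    by (rule subspace_diff[OF subspace_P2 v assms(2)])
  ultimately have "v - u \<in> P1 \<inter> P2"
    by simp
  then have "v - u = 0"
    unfolding direct_P1_P2 by simp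
  then show "v = u"
    by simp
qed

lemma linear_on_pr2: "linear_on scale P P2 (pr2 P1 P2)"
  unfolding linear_on_def
proof (intro conjI ballI allI Pi_I)
  fix p assume "p \<in> P"
  then obtain x u where p: "p = x + u" "x \<in> P1" "u \<in> P2"
    using sum_P1_P2 by blast
  then show "pr2 P1 P2 p \<in> P2"
    by (simp add: pr2_sum)
  show "pr2 P1 P2 (scale c p) = scale c (pr2 P1 P2 p)" for c
    using p by (simp add: scale_right_distrib pr2_sum subspace_scale[OF subspace_P1]
        subspace_scale[OF subspace_P2])
  fix q assume "q \<in> P"
  then obtain y v where q: "q = y + v" "y \<in> P1" "v \<in> P2"
    using sum_P1_P2 by blast
  \<comment> \<open>Regrouping \<open>p + q\<close> by summands exhibits its decomposition, from
    which \<open>pr2_sum\<close> reads off the second component.\<close>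
  have "pr2 P1 P2 ((x + y) + (u + v)) = u + v"
    using p q by (simp add: pr2_sum subspace_add[OF subspace_P1] subspace_add[OF subspace_P2])
  moreover have "p + q = (x + y) + (u + v)"
    using p(1) q(1) by (simp add: add_ac)
  ultimately have "pr2 P1 P2 (p + q) = u + v"
    by simp
  then show "pr2 P1 P2 (p + q) = pr2 P1 P2 p + pr2 P1 P2 q"
    using p(2,3) q(2,3) by (simp add: p(1) q(1) pr2_sum)
qed

lemma linear_on_graph:
  assumes "linear_on scale P2 P1 r"
  shows "linear_on scale P2 P (\<lambda>u. r u + u)"
  unfolding linear_on_def
proof (intro conjI ballI allI Pi_I)
  show "r u + u \<in> P" if "u \<in> P2" for u
    using that linear_on_mem[OF assms] by (simp add: sum_mem)
qed (use assms in \<open>simp_all add: linear_on_def scale_right_distrib add_ac\<close>)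

lemma poisson_algebra_deformation:
  assumes "deformation_map scale P mult brack P1 P2 r"
  shows "poisson_algebra scale P2 (\<lambda>u v. pr2 P1 P2 (mult (r u + u) (r v + v)))
    (\<lambda>u v. pr2 P1 P2 (brack (r u + u) (r v + v)))"
proof -
  have r: "linear_on scale P2 P1 r"
    using assms by (simp add: deformation_map_def)
  \<comment> \<open>Viewing the graph as an image turns the subalgebra condition on \<open>r\<close>
    into the two closure hypotheses of \<open>transport\<close>.\<close>
  have graph: "graph_of P2 r = (\<lambda>u. r u + u) ` P2"
    by (auto simp: graph_of_def)
  show ?thesis
  proof (rule transport[OF subspace_P2 linear_on_graph[OF r] linear_on_pr2])
    show "pr2 P1 P2 (r u + u) = u" if "u \<in> P2" for u
      using that linear_on_mem[OF r] by (simp add: pr2_sum)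
  qed (use assms graph in \<open>auto simp: deformation_map_def poisson_subalgebra_def\<close>)
qed

end

context proto_twilled_structure_maps
begin

text \<open>The decomposition of the product is already a \<open>P1\<close> part plus a
  \<open>P2\<close> part, so \<open>pr2_sum\<close> discards the first. What remains is membership
  of each term, which bilinearity of the structure maps supplies.\<close>

lemma pr2_mult:
  assumes "x \<in> P1" "y \<in> P1" "u \<in> P2" "v \<in> P2"
  shows "pr2 P1 P2 (mult (x + u) (y + v)) = dot2 u v + \<mu> x v + \<mu> y u + h x y"
  unfolding mult_decomp[OF assms]
  using assms by (intro pr2_sum subspace_add[OF subspace_P1] subspace_add[OF subspace_P2]
      bilinear_on_mem[OF dot1_bilinear] bilinear_on_mem[OF dot2_bilinear]
      bilinear_on_mem[OF \<mu>_bilinear] bilinear_on_mem[OF \<nu>_bilinear]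
      bilinear_on_mem[OF h_bilinear] bilinear_on_mem[OF \<theta>_bilinear])

lemma pr2_brack:
  assumes "x \<in> P1" "y \<in> P1" "u \<in> P2" "v \<in> P2"
  shows "pr2 P1 P2 (brack (x + u) (y + v)) = brack2 u v + \<rho> x v - \<rho> y u + H x y"
  unfolding brack_decomp[OF assms]
  using assms by (intro pr2_sum subspace_add[OF subspace_P1] subspace_add[OF subspace_P2]
      subspace_diff[OF subspace_P1] subspace_diff[OF subspace_P2]
      bilinear_on_mem[OF brack1_bilinear] bilinear_on_mem[OF brack2_bilinear]
      bilinear_on_mem[OF \<rho>_bilinear] bilinear_on_mem[OF \<psi>_bilinear]
      bilinear_on_mem[OF H_bilinear] bilinear_on_mem[OF \<Theta>_bilinear])

end

theorem proposition5p9: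
  fixes scale :: "'k::field_char_0 \<Rightarrow> 'v::ab_group_add \<Rightarrow> 'v"
    and P P1 P2 :: "'v set"
    and mult brack :: "'v \<Rightarrow> 'v \<Rightarrow> 'v"
    and dot1 dot2 \<mu> \<nu> h \<theta> :: "'v \<Rightarrow> 'v \<Rightarrow> 'v"
    and brack1 brack2 \<rho> \<psi> H \<Theta> :: "'v \<Rightarrow> 'v \<Rightarrow> 'v"
    and r :: "'v \<Rightarrow> 'v"
  assumes "proto_twilled_poisson_algebra scale P mult brack P1 P2"
    and "proto_twilled_structure_maps scale P mult brack P1 P2
           dot1 dot2 \<mu> \<nu> h \<theta> brack1 brack2 \<rho> \<psi> H \<Theta>"
    and "deformation_map scale P mult brack P1 P2 r"
  shows "let mult_r = (\<lambda>u v. pr2 P1 P2 (mult (r u + u) (r v + v)));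
             brack_r = (\<lambda>u v. pr2 P1 P2 (brack (r u + u) (r v + v)))
         in poisson_algebra scale P2 mult_r brack_r
            \<and> (\<forall>u\<in>P2. \<forall>v\<in>P2.
                 mult_r u v = dot2 u v + \<mu> (r u) v + \<mu> (r v) u + h (r u) (r v)
                 \<and> brack_r u v = brack2 u v + \<rho> (r u) v - \<rho> (r v) u + H (r u) (r v))"
proof -
  interpret proto_twilled_structure_maps scale P mult brack P1 P2
    dot1 dot2 \<mu> \<nu> h \<theta> brack1 brack2 \<rho> \<psi> H \<Theta>
    by (fact assms(2))
  have r: "r u \<in> P1" if "u \<in> P2" for u
    using assms(3) that linear_on_mem by (fastforce simp: deformation_map_def)
  show ?thesis
    \<comment> \<open>The explicit formulas are the projection lemmas at \<open>x = r u\<close> and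
      \<open>y = r v\<close>, which lie in \<open>P1\<close> because \<open>r\<close> maps
      \<open>P2\<close> there.\<close>
    unfolding Let_def
    using poisson_algebra_deformation[OF assms(3)] by (simp add: pr2_mult pr2_brack r)
qed

end
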